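(* Let $\mathbb{F}$ be a field, $d\ge3$, $V$ a vector space over $\mathbb{F}$ of dimension $d+1$, and $\Phi=(A;\{E_i\}_{i=0}^d;A^*;\{E^*_i\}_{i=0}^d)$ a CH system on $V$ with eigenvalue sequence $\{\theta_i\}_{i=0}^d$, dual eigenvalue sequence $\{\theta^*_i\}_{i=0}^d$ and $\Phi$-split sequence $\{\phi_i\}_{i=1}^d$. Fix a nonzero vector $u\in E_0V$. The matrix representing $A^*$ with respect to the basis $\{E^*_iu\}_{i=0}^d$ of $V$ is $\mathrm{diag}(\theta^*_0,\theta^*_1,\ldots,\theta^*_d)$. The matrix representing $A$ with respect to $\{E^*_iu\}_{i=0}^d$ is circular Hessenberg, with $(i,i)$-entry $a_i$ $(0\le i\le d)$, $(i,i+1)$-entry $b_i$ $(0\le i\le d-1)$, $(i,i-1)$-entry $c_i$ $(1\le i\le d)$, $(0,d)$-entry $\xi$, and all other entries $0$, where $$\xi=\theta_0-a_0-b_0$$ and \begin{align*} c_i&=\frac{(\theta^*_i-\theta^*_d)(\theta^*_i-\theta^*_{d-1})\cdots(\theta^*_i-\theta^*_{i+1})}{(\theta^*_{i-1}-\theta^*_d)(\theta^*_{i-1}-\theta^*_{d-1})\cdots(\theta^*_{i-1}-\theta^*_i)}\,\phi_i\qquad(1\le i\le d),\\ a_0&=\theta_d+\frac{\phi_1}{\theta^*_0-\theta^*_1},\\ a_i&=\theta_{d-i}+\frac{\phi_{i+1}}{\theta^*_i-\theta^*_{i+1}}+\frac{\phi_i}{\theta^*_i-\theta^*_{i-1}}\qquad(1\le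 i\le d-1),\\ a_d&=\theta_0+\frac{\phi_d}{\theta^*_d-\theta^*_{d-1}},\\ b_0&=\frac{(\theta^*_0-\theta^*_d)(\theta^*_0-\theta^*_{d-1})\cdots(\theta^*_0-\theta^*_2)}{(\theta^*_1-\theta^*_d)(\theta^*_1-\theta^*_{d-1})\cdots(\theta^*_1-\theta^*_2)}\left(\theta_{d-1}-\theta_d+\frac{\phi_2}{\theta^*_0-\theta^*_2}+\frac{\phi_1}{\theta^*_1-\theta^*_0}\right),\\ b_i&=\frac{(\theta^*_i-\theta^*_d)(\theta^*_i-\theta^*_{d-1})\cdots(\theta^*_i-\theta^*_{i+2})}{(\theta^*_{i+1}-\theta^*_d)(\theta^*_{i+1}-\theta^*_{d-1})\cdots(\theta^*_{i+1}-\theta^*_{i+2})}\\ &\quad\times\left(\theta_{d-i-1}-\theta_{d-i}+\frac{\phi_{i+2}}{\theta^*_i-\theta^*_{i+2}}+\frac{\phi_{i+1}}{\theta^*_{i+1}-\theta^*_i}+\frac{\phi_i}{\theta^*_{i-1}-\theta^*_{i+1}}\right)\qquad(1\le i\le d-2),\\ b_{d-1}&=\theta_0-\theta_1+\frac{\phi_d}{\theta^*_d-\theta^*_{d-1}}+\frac{\phi_{d-1}}{\theta^*_{d-2}-\theta^*_d}. \end{align*}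
   Context: Rows and columns of $(d+1)\times(d+1)$ matrices are indexed by $0,\dots,d$. A matrix $M$ represents $B\in\mathrm{End}(V)$ with respect to a basis $\{w_i\}_{i=0}^d$ if $Bw_j=\sum_iM_{ij}w_i$. A matrix is circular Hessenberg if every entry below the subdiagonal is zero, every subdiagonal entry is nonzero, the $(0,d)$-entry is nonzero, and every other entry above the superdiagonal is zero. An element of $\mathrm{End}(V)$ is multiplicity-free if it is diagonalizable with all eigenspaces of dimension one. The primitive idempotent of a multiplicity-free $B$ for an eigenvalue $\theta$ is the $E\in\mathrm{End}(V)$ acting as the identity on the $\theta$-eigenspace and as $0$ on the other eigenspaces. A CH system on $V$ is a sequence $\Phi=(A;\{E_i\}_{i=0}^d;A^*;\{E^*_i\}_{i=0}^d)$ in $\mathrm{End}(V)$ such that: (i) $A,A^*$ are multiplicity-free; (ii) $\{E_i\}$ is an ordering of the primitive idempotents of $A$; (iii) $\{E^*_i\}$ is an ordering of the primitive idempotents of $A^*$; (iv) $E_iA^*E_j=0$ if $1<i-j$ or $1<j-i<d$, and $E_iA^*E_j\neq0$ if $i-j=1$ or $j-i=d$; (v) $E^*_iAE^*_j=0$ if $1<i-j$ or $1<j-i<d$, and $E^*_iAE^*_j\neq0$ if $i-j=1$ or $j-i=d$ $(0\le i,j\le d)$. $\theta_i$ (resp. $\theta^*_i$) is the eigenvalue of $A$ (resp. $A^*$) corresponding to $E_i$ (resp. $E^*_i$). It is known that there is a unique sequence $\{\phi_i\}_{i=1}^d$ of nonzero scalars (the $\Phi$-split sequence) such that for some basis of $V$,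 $A$ is represented by the lower bidiagonal matrix with $(i,i)$-entry $\theta_{d-i}$ and $(i,i-1)$-entry $1$, and $A^*$ by the upper bidiagonal matrix with $(i,i)$-entry $\theta^*_i$ and $(i-1,i)$-entry $\phi_i$ (all other entries $0$). It is known that $\{E^*_iu\}_{i=0}^d$ is a basis of $V$. Empty products equal $1$. *)

theory Defs
  imports Main "HOL.Vector_Spaces"
begin

text \<open>
  A square matrix of order \<open>d + 1\<close> with rows and columns indexed by \<open>0, \<dots>, d\<close> is a function
  \<open>nat \<Rightarrow> nat \<Rightarrow> 'a\<close> (row index first) of which only the entries with both indices at most \<open>d\<close>
  matter. Likewise a family indexed by \<open>0, \<dots>, d\<close> is a function on \<open>nat\<close> restricted to \<open>{..d}\<close>.
  The vector space is the whole type \<open>'b\<close>, with scalar multiplication \<open>scale\<close>.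
\<close>

definition circular_Hessenberg :: "nat \<Rightarrow> (nat \<Rightarrow> nat \<Rightarrow> 'a::zero) \<Rightarrow> bool" where
  "circular_Hessenberg d M \<longleftrightarrow>
     (\<forall>i\<le>d. \<forall>j\<le>d. j + 1 < i \<longrightarrow> M i j = 0) \<and>
     (\<forall>i\<le>d. \<forall>j\<le>d. i = j + 1 \<longrightarrow> M i j \<noteq> 0) \<and>
     M 0 d \<noteq> 0 \<and>
     (\<forall>i\<le>d. \<forall>j\<le>d. i + 1 < j \<and> (i, j) \<noteq> (0, d) \<longrightarrow> M i j = 0)"

context vector_space
begin

definition indexed_basis :: "nat \<Rightarrow> (nat \<Rightarrow> 'b) \<Rightarrow> bool" where
  "indexed_basis d w \<longleftrightarrow>
     inj_on w {..d} \<and> independent (w ` {..d}) \<and> span (w ` {..d}) = UNIV"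

definition represents :: "nat \<Rightarrow> (nat \<Rightarrow> nat \<Rightarrow> 'a) \<Rightarrow> ('b \<Rightarrow> 'b) \<Rightarrow> (nat \<Rightarrow> 'b) \<Rightarrow> bool" where
  "represents d M B w \<longleftrightarrow> (\<forall>j\<le>d. B (w j) = (\<Sum>i\<le>d. scale (M i j) (w i)))"

definition eigenspace :: "('b \<Rightarrow> 'b) \<Rightarrow> 'a \<Rightarrow> 'b set" where
  "eigenspace B \<theta> = {v. B v = scale \<theta> v}"

definition eigenvalue :: "('b \<Rightarrow> 'b) \<Rightarrow> 'a \<Rightarrow> bool" where
  "eigenvalue B \<theta> \<longleftrightarrow> (\<exists>v. v \<noteq> 0 \<and> v \<in> eigenspace B \<theta>)"

definition diagonalizable :: "('b \<Rightarrow> 'b) \<Rightarrow> bool" where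
  "diagonalizable B \<longleftrightarrow>
     (\<exists>S. independent S \<and> span S = UNIV \<and> (\<forall>v\<in>S. \<exists>\<theta>. v \<in> eigenspace B \<theta>))"

definition multiplicity_free :: "('b \<Rightarrow> 'b) \<Rightarrow> bool" where
  "multiplicity_free B \<longleftrightarrow>
     Vector_Spaces.linear scale scale B \<and> diagonalizable B \<and>
     (\<forall>\<theta>. eigenvalue B \<theta> \<longrightarrow> dim (eigenspace B \<theta>) = 1)"

definition primitive_idempotent :: "('b \<Rightarrow> 'b) \<Rightarrow> 'a \<Rightarrow> ('b \<Rightarrow> 'b) \<Rightarrow> bool" where
  "primitive_idempotent B \<theta> E \<longleftrightarrow>
     eigenvalue B \<theta> \<and> Vector_Spaces.linear scale scale E \<and>
     (\<forall>v \<in> eigenspace B \<theta>. E v = v) \<and>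
     (\<forall>\<eta>. eigenvalue B \<eta> \<and> \<eta> \<noteq> \<theta> \<longrightarrow> (\<forall>v \<in> eigenspace B \<eta>. E v = 0))"

definition ordering_of_primitive_idempotents ::
    "nat \<Rightarrow> ('b \<Rightarrow> 'b) \<Rightarrow> (nat \<Rightarrow> 'b \<Rightarrow> 'b) \<Rightarrow> bool" where
  "ordering_of_primitive_idempotents d B E \<longleftrightarrow>
     bij_betw E {..d} {P. \<exists>\<theta>. primitive_idempotent B \<theta> P}"

text \<open>The inequalities between \<open>i\<close> and \<open>j\<close> are arranged so as to avoid truncated subtraction.\<close>

definition CH_relations :: "nat \<Rightarrow> (nat \<Rightarrow> 'b \<Rightarrow> 'b) \<Rightarrow> ('b \<Rightarrow> 'b) \<Rightarrow> bool" where
  "CH_relations d E B \<longleftrightarrow>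
     (\<forall>i\<le>d. \<forall>j\<le>d.
        (j + 1 < i \<or> i + 1 < j \<and> j < i + d \<longrightarrow> E i \<circ> B \<circ> E j = (\<lambda>v. 0)) \<and>
        (i = j + 1 \<or> j = i + d \<longrightarrow> E i \<circ> B \<circ> E j \<noteq> (\<lambda>v. 0)))"

definition CH_system ::
    "nat \<Rightarrow> ('b \<Rightarrow> 'b) \<Rightarrow> (nat \<Rightarrow> 'b \<Rightarrow> 'b) \<Rightarrow> ('b \<Rightarrow> 'b) \<Rightarrow> (nat \<Rightarrow> 'b \<Rightarrow> 'b) \<Rightarrow> bool" where
  "CH_system d A E As Es \<longleftrightarrow>
     multiplicity_free A \<and> multiplicity_free As \<and>
     ordering_of_primitive_idempotents d A E \<and>
     ordering_of_primitive_idempotents d As Es \<and>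
     CH_relations d E As \<and> CH_relations d Es A"

definition eigenvalue_sequence ::
    "nat \<Rightarrow> ('b \<Rightarrow> 'b) \<Rightarrow> (nat \<Rightarrow> 'b \<Rightarrow> 'b) \<Rightarrow> (nat \<Rightarrow> 'a) \<Rightarrow> bool" where
  "eigenvalue_sequence d B E \<theta> \<longleftrightarrow> (\<forall>i\<le>d. primitive_idempotent B (\<theta> i) (E i))"

text \<open>
  The split sequence is \<open>\<phi> 1, \<dots>, \<phi> d\<close>; the value \<open>\<phi> 0\<close> plays no role.
  The arguments \<open>\<theta>\<close> and \<open>\<theta>s\<close> are the eigenvalue and dual eigenvalue sequences.
\<close>

definition split_sequence ::
    "nat \<Rightarrow> ('b \<Rightarrow> 'b) \<Rightarrow> ('b \<Rightarrow> 'b) \<Rightarrow> (nat \<Rightarrow> 'a) \<Rightarrow> (nat \<Rightarrow> 'a) \<Rightarrow> (nat \<Rightarrow> 'a) \<Rightarrow> bool" where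
  "split_sequence d A As \<theta> \<theta>s \<phi> \<longleftrightarrow>
     (\<forall>i\<in>{1..d}. \<phi> i \<noteq> 0) \<and>
     (\<exists>w. indexed_basis d w \<and>
        represents d
          (\<lambda>i j. if i = j then \<theta> (d - i) else if i = j + 1 then 1 else 0) A w \<and>
        represents d
          (\<lambda>i j. if i = j then \<theta>s i else if j = i + 1 then \<phi> j else 0) As w)"

end

end

(*
  In the split basis w, the last vector spans the eigenspace of A for theta_0, so u is a multiple
  of it, and suitable multiples x_j of w_j satisfy x_j = (A* - theta*_(j+1)) ... (A* - theta*_d) u.
  Hence x_j has coordinates tau_j(theta*_i) in the vectors E*_i u, where tau_j(x) is the product of
  the x - theta*_h over h > j; in particular these vectors span V. Comparing coordinates in
  A x_j = theta_(d-j) x_j + phi_(j+1) x_(j+1) gives linear equations for each row of the matrix of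
  A. Since tau_j vanishes at theta*_k for k > j, row i is determined successively: j = i-1, i, i+1
  yield the entries c_i, a_i, b_i, and j = d says that every row sums to theta_0, which yields xi.
*)

theory Submission
  imports Defs
begin

section \<open>Linear maps and bases indexed by \<open>{..d}\<close>\<close>

context vector_space
begin

lemma indexed_basis_linear_eqI:
  assumes "indexed_basis d w"
    and "Vector_Spaces.linear scale scale f" "Vector_Spaces.linear scale scale g"
    and "\<And>i. i \<le> d \<Longrightarrow> f (w i) = g (w i)"
  shows "f = g"
proof
  fix x
  interpret vector_space_pair scale scale by unfold_locales
  have "x \<in> span (w ` {..d})" using assms(1) by (simp add: indexed_basis_def)
  then show "f x = g x"
    by (rule linear_eq_on_span[OF assms(2,3), rotated]) (use assms(4) in auto)
qed

text \<open>Eigenvectors span, so agreement on them suffices. An independent set does not contain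
  zero, so only nonzero \<open>v\<close> have to be tested; for these \<open>\<eta>\<close> is known
  to be an eigenvalue.\<close>

lemma diagonalizable_linear_eqI:
  assumes "diagonalizable B"
    and "Vector_Spaces.linear scale scale f" "Vector_Spaces.linear scale scale g"
    and "\<And>v \<eta>. v \<in> eigenspace B \<eta> \<Longrightarrow> v \<noteq> 0 \<Longrightarrow> f v = g v"
  shows "f = g"
proof
  fix x
  interpret vector_space_pair scale scale by unfold_locales
  obtain S where S: "span S = UNIV" "\<forall>v\<in>S. \<exists>\<eta>. v \<in> eigenspace B \<eta>" "independent S"
    using assms(1) by (auto simp: diagonalizable_def)
  have "x \<in> span S" using S by simp
  then show "f x = g x"
  proof (rule linear_eq_on_span[OF assms(2,3), rotated])
    fix v assume "v \<in> S"
    moreover from this have "v \<noteq> 0" using S(3) dependent_zero by blast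
    ultimately show "f v = g v" using S(2) assms(4) by blast
  qed
qed

lemma linear_family_sum:
  assumes "Vector_Spaces.linear scale scale f"
  shows "f (\<Sum>i\<in>I. scale (c i) (w i)) = (\<Sum>i\<in>I. scale (c i) (f (w i)))"
proof -
  interpret vector_space_pair scale scale by unfold_locales
  show ?thesis by (simp add: linear_sum[OF assms] linear_scale[OF assms])
qed

lemma indexed_basis_expansion:
  assumes "indexed_basis d w"
  obtains c where "x = (\<Sum>i\<le>d. scale (c i) (w i))"
proof -
  have "x \<in> span (w ` {..d})" "inj_on w {..d}"
    using assms by (auto simp: indexed_basis_def)
  then obtain r where "x = (\<Sum>v\<in>w ` {..d}. scale (r v) v)"
    by (auto simp: span_finite)
  then have "x = (\<Sum>i\<le>d. scale (r (w i)) (w i))"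
    using \<open>inj_on w {..d}\<close> by (simp add: sum.reindex)
  then show ?thesis by (rule that)
qed

lemma indexed_basis_represents:
  assumes "indexed_basis d w"
  obtains M where "represents d M B w"
proof -
  have "\<exists>c. B (w j) = (\<Sum>i\<le>d. scale (c i) (w i))" for j
    using indexed_basis_expansion[OF assms] by metis
  then obtain C where "\<And>j. B (w j) = (\<Sum>i\<le>d. scale (C j i) (w i))" by metis
  then have "represents d (\<lambda>i j. C j i) B w" by (simp add: represents_def)
  then show ?thesis by (rule that)
qed

lemma finite_dimensional_indexed_basis:
  assumes "indexed_basis d w"
  shows "finite_dimensional_vector_space scale (w ` {..d})"
  using assms by unfold_locales (auto simp: indexed_basis_def)

text \<open>Counting: the image of \<open>e\<close> has at most \<open>d + 1\<close> elements and
  spans a space of dimension \<open>d + 1\<close>, which forces both injectivity and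
  independence.\<close>

lemma indexed_basis_spanning:
  assumes w: "indexed_basis d w" and "\<And>i. i \<le> d \<Longrightarrow> w i \<in> span (e ` {..d})"
  shows "indexed_basis d e"
proof -
  interpret finite_dimensional_vector_space scale "w ` {..d}"
    by (rule finite_dimensional_indexed_basis[OF w])
  have "w ` {..d} \<subseteq> span (e ` {..d})" using assms(2) by auto
  then have sp: "span (e ` {..d}) = UNIV"
    using w span_minimal[OF _ subspace_span] unfolding indexed_basis_def by blast
  have dim: "dim UNIV = Suc d"
    using w by (simp add: indexed_basis_def dim_UNIV card_image)
  have ge: "Suc d \<le> card (e ` {..d})"
    using dim_le_card[of UNIV "e ` {..d}"] sp dim by simp
  then have "card (e ` {..d}) = card {..d}"
    using card_image_le[of "{..d}" e] by simp
  then have "inj_on e {..d}" by (simp add: eq_card_imp_inj_on)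
  moreover have "independent (e ` {..d})"
    by (rule card_le_dim_spanning[of _ UNIV]) (use sp dim card_image_le[of "{..d}" e] in auto)
  ultimately show ?thesis using sp by (simp add: indexed_basis_def)
qed

text \<open>The hypothesis concerns coefficients attached to indices, so besides independence of the
  image it excludes repetitions. Spanning then follows from the dimension.\<close>

lemma indexed_basis_independent:
  assumes w: "indexed_basis d w"
    and e: "\<And>c. (\<Sum>i\<le>d. scale (c i) (e i)) = 0 \<Longrightarrow> \<forall>i\<le>d. c i = 0"
  shows "indexed_basis d e"
proof -
  interpret finite_dimensional_vector_space scale "w ` {..d}"
    by (rule finite_dimensional_indexed_basis[OF w])
  have inj: "inj_on e {..d}"
  proof (rule inj_onI, rule ccontr)
    fix i j assume ij: "i \<in> {..d}" "j \<in> {..d}" "e i = e j" "i \<noteq> j"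
    \<comment> \<open>A repetition would give the nontrivial relation
      \<open>e i - e j = 0\<close>.\<close>
    let ?c = "\<lambda>k. if k = i then 1 else if k = j then -1 else 0 :: 'a"
    have "(\<Sum>k\<le>d. scale (?c k) (e k)) = (\<Sum>k\<in>{i,j}. scale (?c k) (e k))"
      by (rule sum.mono_neutral_right) (use ij in auto)
    also have "\<dots> = 0" using ij by simp
    finally have "?c i = 0" using e[of ?c] ij by auto
    then show False by simp
  qed
  have ind: "independent (e ` {..d})"
  proof (rule independent_if_scalars_zero)
    fix f x assume "(\<Sum>x\<in>e ` {..d}. scale (f x) x) = 0" and x: "x \<in> e ` {..d}"
    then have "(\<Sum>i\<le>d. scale (f (e i)) (e i)) = 0" using inj by (simp add: sum.reindex)
    from e[OF this] x show "f x = 0" by auto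
  qed simp
  have "dim UNIV = Suc d"
    using w by (simp add: indexed_basis_def dim_UNIV card_image)
  then have "UNIV \<subseteq> span (e ` {..d})"
    by (intro card_ge_dim_independent ind) (auto simp: card_image inj)
  then show ?thesis using inj ind by (auto simp: indexed_basis_def)
qed

section \<open>Primitive idempotents of a multiplicity-free map\<close>

text \<open>The definition prescribes values of \<open>P\<close> on eigenvectors only. There
  \<open>B \<circ> P\<close> agrees with \<open>\<theta>\<close> times \<open>P\<close>, hence
  everywhere.\<close>

lemma primitive_idempotent_range:
  assumes "multiplicity_free B" "primitive_idempotent B \<theta> P"
  shows "P x \<in> eigenspace B \<theta>"
proof -
  interpret vector_space_pair scale scale by unfold_locales
  have B: "Vector_Spaces.linear scale scale B" "diagonalizable B"
    using assms(1) by (auto simp: multiplicity_free_def)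
  have P: "Vector_Spaces.linear scale scale P"
    using assms(2) by (auto simp: primitive_idempotent_def)
  have "B \<circ> P = (\<lambda>x. scale \<theta> (P x))"
  proof (rule diagonalizable_linear_eqI[OF B(2)])
    show "Vector_Spaces.linear scale scale (B \<circ> P)"
      using P B(1) by (rule Vector_Spaces.linear_compose)
    show "Vector_Spaces.linear scale scale (\<lambda>x. scale \<theta> (P x))"
      by (rule linear_compose_scale_right[OF P])
    fix v \<eta> assume v: "v \<in> eigenspace B \<eta>" "v \<noteq> 0"
    then have "eigenvalue B \<eta>" by (auto simp: eigenvalue_def)
    then show "(B \<circ> P) v = scale \<theta> (P v)"
      using v assms(2) linear_0[OF B(1)]
      by (cases "\<eta> = \<theta>") (auto simp: primitive_idempotent_def eigenspace_def)
  qed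
  then show ?thesis by (simp add: fun_eq_iff eigenspace_def)
qed

text \<open>Since eigenvectors span, a primitive idempotent is determined by its eigenvalue; a
  repeated eigenvalue would repeat an idempotent in the ordering.\<close>

lemma eigenvalue_sequence_inj:
  assumes "multiplicity_free B" "ordering_of_primitive_idempotents d B P"
    "eigenvalue_sequence d B P \<theta>"
  shows "inj_on \<theta> {..d}"
proof (rule inj_onI)
  fix i j assume ij: "i \<in> {..d}" "j \<in> {..d}" "\<theta> i = \<theta> j"
  have pi: "primitive_idempotent B (\<theta> i) (P i)" "primitive_idempotent B (\<theta> i) (P j)"
    using assms(3) ij by (auto simp: eigenvalue_sequence_def)
  have "P i = P j"
  proof (rule diagonalizable_linear_eqI[of B])
    show "diagonalizable B" using assms(1) by (simp add: multiplicity_free_def)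
    fix v \<eta> assume v: "v \<in> eigenspace B \<eta>" "v \<noteq> 0"
    then have "eigenvalue B \<eta>" by (auto simp: eigenvalue_def)
    then show "P i v = P j v"
      using v pi by (cases "\<eta> = \<theta> i") (auto simp: primitive_idempotent_def)
  qed (use pi in \<open>auto simp: primitive_idempotent_def\<close>)
  then show "i = j"
    using assms(2) ij by (auto simp: ordering_of_primitive_idempotents_def bij_betw_def inj_on_def)
qed

lemma primitive_idempotents_orthogonal:
  assumes "multiplicity_free B" "ordering_of_primitive_idempotents d B P"
    "eigenvalue_sequence d B P \<theta>"
    and "i \<le> d" "j \<le> d" "v \<in> eigenspace B (\<theta> j)"
  shows "P i v = (if i = j then v else 0)"
proof -
  have "inj_on \<theta> {..d}" by (rule eigenvalue_sequence_inj) fact+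
  then have "i \<noteq> j \<Longrightarrow> \<theta> j \<noteq> \<theta> i" using assms(4,5) by (auto simp: inj_on_def)
  moreover have "primitive_idempotent B (\<theta> i) (P i)" "eigenvalue B (\<theta> j)"
    using assms(3-5) by (auto simp: eigenvalue_sequence_def primitive_idempotent_def)
  ultimately show ?thesis using assms(6) by (auto simp: primitive_idempotent_def)
qed

text \<open>Applying \<open>P i\<close> to a vanishing combination isolates its \<open>i\<close>-th
  term. The basis \<open>w\<close> supplies the dimension \<open>d + 1\<close>.\<close>

lemma eigenvector_indexed_basis:
  assumes B: "multiplicity_free B" "ordering_of_primitive_idempotents d B P"
    "eigenvalue_sequence d B P \<theta>"
    and w: "indexed_basis d w"
    and v: "\<And>i. i \<le> d \<Longrightarrow> v i \<in> eigenspace B (\<theta> i)" "\<And>i. i \<le> d \<Longrightarrow> v i \<noteq> 0"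
  shows "indexed_basis d v"
proof (rule indexed_basis_independent[OF w], intro allI impI)
  fix c i assume s: "(\<Sum>i\<le>d. scale (c i) (v i)) = 0" and i: "i \<le> d"
  interpret vector_space_pair scale scale by unfold_locales
  have P: "Vector_Spaces.linear scale scale (P i)"
    using B(3) i by (auto simp: eigenvalue_sequence_def primitive_idempotent_def)
  have "0 = P i (\<Sum>i\<le>d. scale (c i) (v i))" using s linear_0[OF P] by simp
  also have "\<dots> = (\<Sum>k\<le>d. scale (c k) (P i (v k)))" by (rule linear_family_sum[OF P])
  also have "\<dots> = (\<Sum>k\<le>d. if k = i then scale (c i) (v i) else 0)"
    by (rule sum.cong) (auto simp: primitive_idempotents_orthogonal[OF B i _ v(1)])
  also have "\<dots> = scale (c i) (v i)" using i by simp
  finally show "c i = 0" using v(2)[OF i] by simp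
qed

text \<open>Resolution of the identity, checked on a basis made of one eigenvector for each
  \<open>\<theta> i\<close>.\<close>

lemma primitive_idempotents_sum:
  assumes B: "multiplicity_free B" "ordering_of_primitive_idempotents d B P"
    "eigenvalue_sequence d B P \<theta>"
    and w: "indexed_basis d w"
  shows "(\<Sum>i\<le>d. P i x) = x"
proof -
  interpret vector_space_pair scale scale by unfold_locales
  have "\<forall>i. \<exists>v. i \<le> d \<longrightarrow> v \<in> eigenspace B (\<theta> i) \<and> v \<noteq> 0"
    using B(3) by (fastforce simp: eigenvalue_sequence_def primitive_idempotent_def eigenvalue_def)
  then obtain v where v: "\<And>i. i \<le> d \<Longrightarrow> v i \<in> eigenspace B (\<theta> i)"
    "\<And>i. i \<le> d \<Longrightarrow> v i \<noteq> 0" by metis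
  have "(\<lambda>x. \<Sum>i\<le>d. P i x) = (\<lambda>x. x)"
  proof (rule indexed_basis_linear_eqI[OF eigenvector_indexed_basis[OF B w v]])
    show "Vector_Spaces.linear scale scale (\<lambda>x. \<Sum>i\<le>d. P i x)"
      by (rule linear_compose_sum)
        (use B(3) in \<open>auto simp: eigenvalue_sequence_def primitive_idempotent_def\<close>)
    show "Vector_Spaces.linear scale scale (\<lambda>x. x)" by (rule linear_ident)
    fix j assume j: "j \<le> d"
    have "(\<Sum>i\<le>d. P i (v j)) = (\<Sum>i\<le>d. if i = j then v j else 0)"
      by (rule sum.cong) (auto simp: primitive_idempotents_orthogonal[OF B _ j v(1)[OF j]])
    then show "(\<Sum>i\<le>d. P i (v j)) = v j" using j by simp
  qed
  then show ?thesis by (rule fun_cong)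
qed

section \<open>The split basis and its expansion in the vectors \<open>P i u\<close>\<close>

text \<open>The last column of the lower bidiagonal matrix has only its diagonal entry
  \<open>\<theta> 0\<close>, so \<open>w d\<close> spans the one-dimensional eigenspace that
  contains \<open>u\<close>.\<close>

lemma split_basis_last:
  assumes A: "multiplicity_free A" and E: "primitive_idempotent A (\<theta> 0) P"
    and w: "indexed_basis d w"
    and rep: "represents d
      (\<lambda>i j. if i = j then \<theta> (d - i) else if i = j + 1 then 1 else 0) A w"
    and u: "u \<in> range P"
  obtains \<alpha> where "u = scale \<alpha> (w d)"
proof -
  interpret finite_dimensional_vector_space scale "w ` {..d}"
    by (rule finite_dimensional_indexed_basis[OF w])
  have "A (w d) = (\<Sum>i\<le>d. scale (if i = d then \<theta> (d - i)
      else if i = d + 1 then 1 else 0) (w i))"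
    using rep by (simp add: represents_def)
  also have "\<dots> = (\<Sum>i\<le>d. if i = d then scale (\<theta> 0) (w d) else 0)"
    by (rule sum.cong) auto
  finally have wd: "{w d} \<subseteq> eigenspace A (\<theta> 0)" by (simp add: eigenspace_def)
  have ind: "independent {w d}"
    using w independent_mono[of "w ` {..d}" "{w d}"] by (simp add: indexed_basis_def)
  have "dim (eigenspace A (\<theta> 0)) = 1"
    using A E by (auto simp: multiplicity_free_def primitive_idempotent_def)
  then have "eigenspace A (\<theta> 0) \<subseteq> span {w d}"
    using card_ge_dim_independent[OF wd ind] by simp
  moreover have "u \<in> eigenspace A (\<theta> 0)"
    using u primitive_idempotent_range[OF A E] by auto
  ultimately show ?thesis using that by (auto simp: span_singleton)
qed

text \<open>
  Rescaling the split basis to \<open>x j = \<phi> (j+1) \<cdots> \<phi> d w j\<close> (up to a common factor) turns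
  the recursion for \<open>As\<close> into \<open>x j = (As - \<theta>s (j+1)) x (j+1)\<close>, so that \<open>x j\<close> is a product
  of factors \<open>As - \<theta>s h\<close> applied to \<open>u\<close> and expands explicitly in the vectors \<open>P i u\<close>.
\<close>

lemma rescaled_split_basis_expansion:
  fixes \<phi> :: "nat \<Rightarrow> 'a"
  assumes B: "multiplicity_free B" "ordering_of_primitive_idempotents d B P"
    "eigenvalue_sequence d B P \<theta>"
    and w: "indexed_basis d w"
    and rep: "represents d
      (\<lambda>i j. if i = j then \<theta> i else if j = i + 1 then \<phi> j else 0) B w"
    and u: "u = scale \<alpha> (w d)"
    and "j \<le> d"
  shows "scale (\<alpha> * (\<Prod>h=Suc j..d. \<phi> h)) (w j) =
    (\<Sum>i\<le>d. scale (\<Prod>h=Suc j..d. \<theta> i - \<theta> h) (P i u))"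
  using \<open>j \<le> d\<close>
\<comment> \<open>Downward induction: at \<open>j = d\<close> the products are empty and the claim
  is the resolution of the identity applied to \<open>u\<close>.\<close>
proof (induction rule: inc_induct)
  case base
  show ?case using primitive_idempotents_sum[OF B w] u by simp
next
  case (step j)
  interpret vector_space_pair scale scale by unfold_locales
  have lin: "Vector_Spaces.linear scale scale B"
    using B(1) by (simp add: multiplicity_free_def)
  let ?c = "\<lambda>j. \<alpha> * (\<Prod>h=Suc j..d. \<phi> h)"
  have "B (w (Suc j)) = (\<Sum>i\<le>d. scale (if i = Suc j then \<theta> i
      else if Suc j = i + 1 then \<phi> (Suc j) else 0) (w i))"
    using rep step(2) by (simp add: represents_def)
  also have "\<dots> = (\<Sum>i\<in>{j, Suc j}. scale (if i = Suc j then \<theta> i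
      else if Suc j = i + 1 then \<phi> (Suc j) else 0) (w i))"
    by (rule sum.mono_neutral_right) (use step(2) in auto)
  finally have Bw: "B (w (Suc j)) =
      scale (\<phi> (Suc j)) (w j) + scale (\<theta> (Suc j)) (w (Suc j))" by simp
  have pr: "(\<Prod>h=Suc j..d. f h) = f (Suc j) * (\<Prod>h=Suc (Suc j)..d. f h)"
    for f :: "nat \<Rightarrow> 'a"
    using step(2) by (intro prod.atLeast_Suc_atMost) simp
  \<comment> \<open>Solving \<open>Bw\<close> for \<open>w j\<close>: up to scaling, passing from
    \<open>Suc j\<close> to \<open>j\<close> means applying
    \<open>B - \<theta> (Suc j)\<close>.\<close>
  have "scale (?c j) (w j) = scale (?c (Suc j)) (scale (\<phi> (Suc j)) (w j))"
    by (simp add: pr[of \<phi>] mult_ac)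
  also have "\<dots> = B (scale (?c (Suc j)) (w (Suc j)))
      - scale (\<theta> (Suc j)) (scale (?c (Suc j)) (w (Suc j)))"
    by (simp add: linear_scale[OF lin] Bw scale_right_distrib mult_ac)
  also have "\<dots> = B (\<Sum>i\<le>d. scale (\<Prod>h=Suc (Suc j)..d. \<theta> i - \<theta> h) (P i u))
      - scale (\<theta> (Suc j)) (\<Sum>i\<le>d. scale (\<Prod>h=Suc (Suc j)..d. \<theta> i - \<theta> h) (P i u))"
    by (simp only: step.IH)
  also have "\<dots> = (\<Sum>i\<le>d. scale (\<Prod>h=Suc (Suc j)..d. \<theta> i - \<theta> h) (B (P i u)))
      - (\<Sum>i\<le>d. scale (\<theta> (Suc j) * (\<Prod>h=Suc (Suc j)..d. \<theta> i - \<theta> h)) (P i u))"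
    by (simp add: linear_family_sum[OF lin] scale_sum_right)
  \<comment> \<open>On \<open>P i u\<close> the map \<open>B - \<theta> (Suc j)\<close> is
    multiplication by \<open>\<theta> i - \<theta> (Suc j)\<close>, the new factor of the
    product.\<close>
  also have "\<dots> = (\<Sum>i\<le>d. scale (\<Prod>h=Suc j..d. \<theta> i - \<theta> h) (P i u))"
    unfolding sum_subtractf[symmetric]
  proof (rule sum.cong)
    fix i assume "i \<in> {..d}"
    then have "P i u \<in> eigenspace B (\<theta> i)"
      using B(3) by (intro primitive_idempotent_range[OF B(1)]) (simp add: eigenvalue_sequence_def)
    then have BP: "B (P i u) = scale (\<theta> i) (P i u)" by (simp add: eigenspace_def)
    show "scale (\<Prod>h=Suc (Suc j)..d. \<theta> i - \<theta> h) (B (P i u))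
        - scale (\<theta> (Suc j) * (\<Prod>h=Suc (Suc j)..d. \<theta> i - \<theta> h)) (P i u)
      = scale (\<Prod>h=Suc j..d. \<theta> i - \<theta> h) (P i u)"
      by (simp add: BP pr[of "\<lambda>h. \<theta> i - \<theta> h"] scale_left_diff_distrib[symmetric] algebra_simps
        del: scale_left_diff_distrib)
  qed simp
  finally show ?case .
qed

end


section \<open>Solving the row equations over the field\<close>

text \<open>Isolates the part of the argument that involves scalars only. \<open>row\<close> is the
  \<open>i\<close>-th coordinate of the formula for A x_j; there is no x_(d+1), whence the case
  \<open>j < d\<close>.\<close>

locale bidiagonal_rows =
  fixes d :: nat and \<theta> \<theta>s \<phi> :: "nat \<Rightarrow> 'a::field" and M :: "nat \<Rightarrow> nat \<Rightarrow> 'a"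
  assumes inj: "inj_on \<theta>s {..d}"
    and lower: "i \<le> d \<Longrightarrow> j + 1 < i \<Longrightarrow> M i j = 0"
    and row: "i \<le> d \<Longrightarrow> j \<le> d \<Longrightarrow>
      (\<Sum>k\<le>d. M i k * (\<Prod>h=Suc j..d. \<theta>s k - \<theta>s h)) =
      \<theta> (d - j) * (\<Prod>h=Suc j..d. \<theta>s i - \<theta>s h) +
      (if j < d then \<phi> (Suc j) * (\<Prod>h=Suc (Suc j)..d. \<theta>s i - \<theta>s h) else 0)"
begin

text \<open>For \<open>j \<le> d\<close>, the monic polynomial of degree \<open>d - j\<close> with
  roots \<open>\<theta>s h\<close>, \<open>j < h \<le> d\<close>. The products in the formulas for
  the entries are its values.\<close>

definition tau :: "nat \<Rightarrow> 'a \<Rightarrow> 'a" where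
  "tau j x = (\<Prod>h=Suc j..d. x - \<theta>s h)"

lemma tau_Suc: "j < d \<Longrightarrow> tau j x = (x - \<theta>s (Suc j)) * tau (Suc j) x"
  unfolding tau_def by (rule prod.atLeast_Suc_atMost) simp

lemma tau_eq_0: "j < i \<Longrightarrow> i \<le> d \<Longrightarrow> tau j (\<theta>s i) = 0"
  unfolding tau_def by (rule prod_zero) auto

lemma diff_neq_0: "i \<le> d \<Longrightarrow> j \<le> d \<Longrightarrow> i \<noteq> j \<Longrightarrow> \<theta>s i - \<theta>s j \<noteq> 0"
  using inj by (auto simp: inj_on_def)

lemma tau_neq_0: "i \<le> j \<Longrightarrow> i \<le> d \<Longrightarrow> tau j (\<theta>s i) \<noteq> 0"
  unfolding tau_def using diff_neq_0[of i] by (simp add: prod_zero_iff)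

text \<open>\<open>M i k\<close> vanishes for \<open>k + 1 < i\<close> and \<open>tau j\<close>
  vanishes at \<open>\<theta>s k\<close> for \<open>k > j\<close>, so few unknowns survive. For
  \<open>i = 0\<close> truncated subtraction starts the range at \<open>0\<close>.\<close>

lemma row_tau:
  assumes "i \<le> d" "j \<le> d"
  shows "(\<Sum>k=i-1..j. M i k * tau j (\<theta>s k)) =
    \<theta> (d - j) * tau j (\<theta>s i) + (if j < d then \<phi> (Suc j) * tau (Suc j) (\<theta>s i) else 0)"
proof -
  have "(\<Sum>k\<le>d. M i k * tau j (\<theta>s k)) = (\<Sum>k=i-1..j. M i k * tau j (\<theta>s k))"
  proof (rule sum.mono_neutral_right)
    show "\<forall>k\<in>{..d} - {i-1..j}. M i k * tau j (\<theta>s k) = 0"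
    proof
      fix k assume "k \<in> {..d} - {i-1..j}"
      then have "k + 1 < i \<or> j < k \<and> k \<le> d" by auto
      then show "M i k * tau j (\<theta>s k) = 0"
        using lower[OF assms(1)] tau_eq_0[of j k] by auto
    qed
  qed (use assms in auto)
  then show ?thesis using row[OF assms] unfolding tau_def by simp
qed

text \<open>In row \<open>Suc i\<close>, equation \<open>j = i\<close> has the single unknown
  \<open>M (Suc i) i\<close>, and its \<open>\<theta>\<close> term vanishes since
  \<open>\<theta>s (Suc i)\<close> is a root of \<open>tau i\<close>.\<close>

lemma subdiagonal_entry:
  assumes "i < d"
  shows "M (Suc i) i = tau (Suc i) (\<theta>s (Suc i)) / tau i (\<theta>s i) * \<phi> (Suc i)"
  using row_tau[of "Suc i" i] assms tau_neq_0[of i i] tau_eq_0[of i "Suc i"]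
  by (simp add: field_simps)

text \<open>The contribution of the subdiagonal entry to the next equation of its row, with
  \<open>tau (Suc i) (\<theta>s i)\<close> cancelled.\<close>

lemma subdiagonal_tau:
  assumes "i < d"
  shows "M (Suc i) i * tau (Suc i) (\<theta>s i) =
    tau (Suc i) (\<theta>s (Suc i)) * (\<phi> (Suc i) / (\<theta>s i - \<theta>s (Suc i)))"
  using subdiagonal_entry[OF assms] tau_Suc[OF assms, of "\<theta>s i"] tau_neq_0[of i "Suc i"] assms
    diff_neq_0[of i "Suc i"]
  by (simp add: field_simps)

text \<open>Equation \<open>j = i\<close> of row \<open>i\<close>, where the term
  \<open>k = i - 1\<close> is already known. The conditionals remove the missing neighbour at either
  end.\<close>

lemma diagonal_entry:
  assumes "i \<le> d"
  shows "M i i = \<theta> (d - i) + (if i < d then \<phi> (Suc i) / (\<theta>s i - \<theta>s (Suc i)) else 0)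
    + (if 0 < i then \<phi> i / (\<theta>s i - \<theta>s (i - 1)) else 0)"
proof -
  let ?T = "tau i (\<theta>s i)"
  let ?c = "if 0 < i then \<phi> i / (\<theta>s i - \<theta>s (i - 1)) else 0"
  let ?p = "if i < d then \<phi> (Suc i) / (\<theta>s i - \<theta>s (Suc i)) else 0"
  have T: "?T \<noteq> 0" using assms by (simp add: tau_neq_0)
  have p: "(if i < d then \<phi> (Suc i) * tau (Suc i) (\<theta>s i) else 0) = ?T * ?p"
    using diff_neq_0[of i "Suc i"] by (simp add: tau_Suc)
  \<comment> \<open>For \<open>i = 0\<close> the range is the single index \<open>0\<close>, in
    agreement with \<open>?c = 0\<close>.\<close>
  have s: "(\<Sum>k=i-1..i. M i k * tau i (\<theta>s k)) = M i i * ?T - ?T * ?c"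
  proof (cases i)
    case (Suc k)
    have "\<phi> i / (\<theta>s k - \<theta>s i) = - (\<phi> i / (\<theta>s i - \<theta>s k))"
      using minus_divide_right[of "\<phi> i" "\<theta>s i - \<theta>s k"] by simp
    then show ?thesis using Suc subdiagonal_tau[of k] assms by simp
  qed simp
  have "M i i * ?T = ?T * (\<theta> (d - i) + ?p + ?c)"
    using row_tau[OF assms assms] s p by (simp add: algebra_simps)
  then show ?thesis using T by simp
qed

text \<open>Equation \<open>j = Suc i\<close> of row \<open>i\<close>, with the two earlier entries
  substituted and \<open>tau (Suc i) (\<theta>s i)\<close> factored out.\<close>

lemma superdiagonal_entry:
  assumes i: "i < d"
  shows "M i (Suc i) = tau (Suc i) (\<theta>s i) / tau (Suc i) (\<theta>s (Suc i)) *
    (\<theta> (d - Suc i) - \<theta> (d - i)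
      + (if Suc i < d then \<phi> (Suc (Suc i)) / (\<theta>s i - \<theta>s (Suc (Suc i))) else 0)
      + \<phi> (Suc i) / (\<theta>s (Suc i) - \<theta>s i)
      + (if 0 < i then \<phi> i / (\<theta>s (i - 1) - \<theta>s (Suc i)) else 0))"
proof -
  let ?T = "tau (Suc i) (\<theta>s i)"
  let ?p = "if Suc i < d then \<phi> (Suc (Suc i)) / (\<theta>s i - \<theta>s (Suc (Suc i))) else 0"
  let ?q = "\<phi> (Suc i) / (\<theta>s (Suc i) - \<theta>s i)"
  let ?c = "if 0 < i then \<phi> i / (\<theta>s (i - 1) - \<theta>s (Suc i)) else 0"
  have p: "(if Suc i < d then \<phi> (Suc (Suc i)) * tau (Suc (Suc i)) (\<theta>s i) else 0) = ?T * ?p"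
    using diff_neq_0[of i "Suc (Suc i)"] by (simp add: tau_Suc)
  have q: "\<phi> (Suc i) / (\<theta>s i - \<theta>s (Suc i)) = - ?q"
    using minus_divide_right[of "\<phi> (Suc i)" "\<theta>s (Suc i) - \<theta>s i"] by simp
  have s: "(\<Sum>k=i-1..Suc i. M i k * tau (Suc i) (\<theta>s k)) =
      M i (Suc i) * tau (Suc i) (\<theta>s (Suc i)) + ?T * (\<theta> (d - i) - ?q - ?c)"
  proof (cases i)
    case 0
    then have "M i i = \<theta> (d - i) - ?q" using diagonal_entry[of i] q i by simp
    then have "M i i * ?T = ?T * (\<theta> (d - i) - ?q)" by simp
    then show ?thesis using 0 by simp
  next
    case (Suc k)
    let ?x = "\<theta>s k" and ?y = "\<theta>s i" and ?z = "\<theta>s (Suc i)"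
    have nz: "?x - ?z \<noteq> 0" "?x - ?y \<noteq> 0"
      using diff_neq_0[of k "Suc i"] diff_neq_0[of k i] Suc i by simp_all
    \<comment> \<open>The factor \<open>?x - ?z\<close> completes \<open>tau (Suc i) ?x\<close> to
      \<open>tau i ?x\<close>, for which the contribution is known.\<close>
    have "(?x - ?z) * (M i k * tau (Suc i) ?x) = M i k * tau i ?x"
      by (simp only: tau_Suc[OF i] mult_ac)
    also have "\<dots> = tau i ?y * (\<phi> i / (?x - ?y))"
      using subdiagonal_tau[of k] Suc i by simp
    also have "\<dots> = ?T * ((?y - ?z) * (\<phi> i / (?x - ?y)))"
      by (simp only: tau_Suc[OF i] mult_ac)
    finally have "(?x - ?z) * (M i k * tau (Suc i) ?x) = ?T * ((?y - ?z) * (\<phi> i / (?x - ?y)))" .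
    then have "M i k * tau (Suc i) ?x = ?T * ((?y - ?z) * (\<phi> i / (?x - ?y)) / (?x - ?z))"
      by (metis nz(1) nonzero_mult_div_cancel_left times_divide_eq_right)
    \<comment> \<open>Partial fractions through \<open>?y - ?z = (?x - ?z) - (?x - ?y)\<close>: the
      part with denominator \<open>?x - ?y\<close> will cancel against the same term of the diagonal
      entry.\<close>
    also have "(?y - ?z) * (\<phi> i / (?x - ?y)) =
        (?x - ?z) * (\<phi> i / (?x - ?y)) - (?x - ?y) * (\<phi> i / (?x - ?y))"
      by (simp only: left_diff_distrib[symmetric]) simp
    also have "\<dots> / (?x - ?z) = \<phi> i / (?x - ?y) - \<phi> i / (?x - ?z)"
      using nz by (simp add: diff_divide_distrib)
    finally have c: "M i k * tau (Suc i) ?x = ?T * (\<phi> i / (?x - ?y) - \<phi> i / (?x - ?z))" .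
    have "\<phi> i / (?y - ?x) = - (\<phi> i / (?x - ?y))"
      using minus_divide_right[of "\<phi> i" "?x - ?y"] by simp
    then have a: "M i i = \<theta> (d - i) - ?q - \<phi> i / (?x - ?y)"
      using diagonal_entry[of i] q Suc i by simp
    have "(\<Sum>k=i-1..Suc i. M i k * tau (Suc i) (\<theta>s k)) =
        M i k * tau (Suc i) ?x + M i i * ?T + M i (Suc i) * tau (Suc i) ?z"
      using Suc by simp
    also have "\<dots> = M i (Suc i) * tau (Suc i) ?z + ?T * (\<theta> (d - i) - ?q - \<phi> i / (?x - ?z))"
      unfolding c a by (simp add: algebra_simps)
    finally show ?thesis using Suc by simp
  qed
  have "M i (Suc i) * tau (Suc i) (\<theta>s (Suc i)) =
      ?T * (\<theta> (d - Suc i) - \<theta> (d - i) + ?p + ?q + ?c)"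
    using row_tau[of i "Suc i"] s p i by (simp add: algebra_simps)
  moreover have "tau (Suc i) (\<theta>s (Suc i)) \<noteq> 0" using i by (simp add: tau_neq_0)
  ultimately show ?thesis by (metis nonzero_mult_div_cancel_right times_divide_eq_left)
qed

text \<open>Since \<open>tau d\<close> is constantly \<open>1\<close>, equation \<open>j = d\<close>
  says that row \<open>0\<close> sums to \<open>\<theta> 0\<close>; \<open>2 \<le> d\<close> keeps
  the columns \<open>0\<close>, \<open>1\<close>, \<open>d\<close> distinct.\<close>

lemma corner_entry:
  assumes "2 \<le> d" and upper: "\<And>j. 1 < j \<Longrightarrow> j < d \<Longrightarrow> M 0 j = 0"
  shows "M 0 d = \<theta> 0 - M 0 0 - M 0 1"
proof -
  have "(\<Sum>k\<le>d. M 0 k) = (\<Sum>k\<in>{0, 1, d}. M 0 k)"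
    by (rule sum.mono_neutral_right) (use assms(1) in \<open>auto intro: upper\<close>)
  moreover have "(\<Sum>k\<le>d. M 0 k) = \<theta> 0" using row[of 0 d] by simp
  ultimately show ?thesis using assms(1) by (auto simp: algebra_simps)
qed

end

section \<open>From the linear maps to equations for the matrix entries\<close>

context vector_space
begin

lemma indexed_basis_coeff_eq:
  assumes "indexed_basis d w"
    and "(\<Sum>i\<le>d. scale (f i) (w i)) = (\<Sum>i\<le>d. scale (g i) (w i))" and "i \<le> d"
  shows "f i = g i"
proof -
  have w: "inj_on w {..d}" "independent (w ` {..d})"
    using assms(1) by (auto simp: indexed_basis_def)
  \<comment> \<open>Independence of a set needs coefficients attached to vectors; inverting
    \<open>w\<close> transports them from the indices.\<close>
  let ?r = "the_inv_into {..d} w"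
  have "(\<Sum>x\<in>w ` {..d}. scale (f (?r x) - g (?r x)) x) = (\<Sum>i\<le>d. scale (f i - g i) (w i))"
    using w(1) by (simp add: sum.reindex the_inv_into_f_f)
  also have "\<dots> = 0" using assms(2) by (simp add: scale_left_diff_distrib sum_subtractf)
  finally have "f (?r (w i)) - g (?r (w i)) = 0"
    using assms(3) by (intro independentD[OF w(2)]) auto
  then show ?thesis using w(1) assms(3) by (simp add: the_inv_into_f_f)
qed

lemma indexed_basis_neq_0: "indexed_basis d w \<Longrightarrow> i \<le> d \<Longrightarrow> w i \<noteq> 0"
  using dependent_zero[of "w ` {..d}"] by (force simp: indexed_basis_def)

text \<open>Computes A x_j for the rescaled vector x_j in two ways, through the columns of
  \<open>M\<close> and through the split basis, and compares coordinates in the basis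
  \<open>P i u\<close>.\<close>

lemma split_basis_bidiagonal_rows:
  fixes \<phi> :: "nat \<Rightarrow> 'a"
  assumes A: "Vector_Spaces.linear scale scale A"
    and B: "multiplicity_free B" "ordering_of_primitive_idempotents d B P"
      "eigenvalue_sequence d B P \<theta>s"
    and w: "indexed_basis d w"
    and repA: "represents d
      (\<lambda>i j. if i = j then \<theta> (d - i) else if i = j + 1 then 1 else 0) A w"
    and repB: "represents d
      (\<lambda>i j. if i = j then \<theta>s i else if j = i + 1 then \<phi> j else 0) B w"
    and u: "u = scale \<alpha> (w d)"
    and e: "indexed_basis d (\<lambda>i. P i u)"
    and M: "represents d M A (\<lambda>i. P i u)"
    and lower: "\<And>i j. i \<le> d \<Longrightarrow> j + 1 < i \<Longrightarrow> M i j = 0"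
  shows "bidiagonal_rows d \<theta> \<theta>s \<phi> M"
proof
  show "inj_on \<theta>s {..d}" by (rule eigenvalue_sequence_inj[OF B])
  show "M i j = 0" if "i \<le> d" "j + 1 < i" for i j by (rule lower[OF that])
next
  fix i j assume i: "i \<le> d" and j: "j \<le> d"
  interpret vector_space_pair scale scale by unfold_locales
  let ?t = "\<lambda>j i. \<Prod>h=Suc j..d. \<theta>s i - \<theta>s h"
  let ?c = "\<lambda>j. \<alpha> * (\<Prod>h=Suc j..d. \<phi> h)"
  let ?\<phi> = "if j < d then \<phi> (Suc j) else 0"
  note exp = rescaled_split_basis_expansion[OF B w repB u]
  have "A (w j) = (\<Sum>i\<le>d. scale (if i = j then \<theta> (d - i)
      else if i = j + 1 then 1 else 0) (w i))"
    using repA j by (simp add: represents_def)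
  also have "\<dots> = (\<Sum>i\<le>d. (if i = j then scale (\<theta> (d - j)) (w j) else 0)
      + (if i = Suc j then w (Suc j) else 0))"
    by (rule sum.cong) auto
  also have "\<dots> = scale (\<theta> (d - j)) (w j) + (if j < d then w (Suc j) else 0)"
    using j by (simp add: sum.distrib Suc_le_eq)
  finally have Aw: "A (w j) = scale (\<theta> (d - j)) (w j) + (if j < d then w (Suc j) else 0)" .
  \<comment> \<open>The rescaling moves \<open>\<phi> (Suc j)\<close> into the matrix of
    \<open>A\<close>, in place of the subdiagonal entry \<open>1\<close>.\<close>
  have c: "?c j = ?c (Suc j) * \<phi> (Suc j)" if "j < d"
    using that prod.atLeast_Suc_atMost[of "Suc j" d \<phi>] by simp
  have "(\<Sum>i\<le>d. scale (\<Sum>k\<le>d. M i k * ?t j k) (P i u)) =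
      (\<Sum>i\<le>d. \<Sum>k\<le>d. scale (?t j k) (scale (M i k) (P i u)))"
    by (simp add: scale_sum_left mult.commute)
  also have "\<dots> = (\<Sum>k\<le>d. scale (?t j k) (A (P k u)))"
    using M by (subst sum.swap) (simp add: represents_def scale_sum_right)
  also have "\<dots> = A (scale (?c j) (w j))"
    by (simp only: exp[OF j] linear_family_sum[OF A])
  also have "\<dots> = scale (\<theta> (d - j)) (scale (?c j) (w j))
      + scale ?\<phi> (scale (?c (Suc j)) (if j < d then w (Suc j) else 0))"
    using c by (auto simp: linear_scale[OF A] Aw scale_right_distrib mult_ac)
  also have "\<dots> = scale (\<theta> (d - j)) (\<Sum>i\<le>d. scale (?t j i) (P i u))
      + scale ?\<phi> (\<Sum>i\<le>d. scale (?t (Suc j) i) (P i u))"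
    using exp[OF j] exp[of "Suc j"] by (cases "j < d") simp_all
  also have "\<dots> = (\<Sum>i\<le>d. scale (\<theta> (d - j) * ?t j i + ?\<phi> * ?t (Suc j) i) (P i u))"
    by (simp add: scale_sum_right scale_left_distrib sum.distrib)
  finally have "(\<Sum>k\<le>d. M i k * ?t j k) = \<theta> (d - j) * ?t j i + ?\<phi> * ?t (Suc j) i"
    by (rule indexed_basis_coeff_eq[OF e _ i])
  then show "(\<Sum>k\<le>d. M i k * ?t j k) = \<theta> (d - j) * ?t j i
      + (if j < d then \<phi> (Suc j) * ?t (Suc j) i else 0)"
    by simp
qed

text \<open>\<open>P i (A (P j u))\<close> is \<open>M i j\<close> times the nonzero vector
  \<open>P i u\<close>, and \<open>P j\<close> kills the other basis vectors. This carries the CH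
  relations over to \<open>M\<close>.\<close>

lemma represents_idempotent_entry_eq_0_iff:
  assumes A: "Vector_Spaces.linear scale scale A"
    and B: "multiplicity_free B" "ordering_of_primitive_idempotents d B P"
      "eigenvalue_sequence d B P \<theta>s"
    and e: "indexed_basis d (\<lambda>i. P i u)"
    and M: "represents d M A (\<lambda>i. P i u)"
    and ij: "i \<le> d" "j \<le> d"
  shows "M i j = 0 \<longleftrightarrow> P i \<circ> A \<circ> P j = (\<lambda>v. 0)"
proof -
  interpret vector_space_pair scale scale by unfold_locales
  have P: "Vector_Spaces.linear scale scale (P k)" if "k \<le> d" for k
    using B(3) that by (auto simp: eigenvalue_sequence_def primitive_idempotent_def)
  have PP: "P i (P k u) = (if i = k then P k u else 0)" if "i \<le> d" "k \<le> d" for i k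
    using B(3) that
    by (intro primitive_idempotents_orthogonal[OF B] primitive_idempotent_range[OF B(1)])
      (auto simp: eigenvalue_sequence_def)
  have "P i (A (P j u)) = (\<Sum>k\<le>d. scale (M k j) (P i (P k u)))"
    using M ij by (simp add: represents_def linear_family_sum[OF P])
  also have "\<dots> = (\<Sum>k\<le>d. if k = i then scale (M i j) (P i u) else 0)"
    by (rule sum.cong) (auto simp: PP ij)
  finally have PAP: "P i (A (P j u)) = scale (M i j) (P i u)" using ij by simp
  show ?thesis
  proof
    assume "M i j = 0"
    show "P i \<circ> A \<circ> P j = (\<lambda>v. 0)"
    proof (rule indexed_basis_linear_eqI[OF e])
      show "Vector_Spaces.linear scale scale (P i \<circ> A \<circ> P j)"
        using P ij A by (intro Vector_Spaces.linear_compose) auto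
      show "Vector_Spaces.linear scale scale (\<lambda>v. 0)" by (rule linear_zero)
      show "(P i \<circ> A \<circ> P j) (P k u) = 0" if "k \<le> d" for k
        using that ij PAP \<open>M i j = 0\<close> by (cases "j = k") (simp_all add: PP linear_0[OF A] linear_0[OF P])
    qed
  next
    assume "P i \<circ> A \<circ> P j = (\<lambda>v. 0)"
    then have "P i (A (P j u)) = 0" by (metis comp_apply)
    then show "M i j = 0" using PAP indexed_basis_neq_0[OF e ij(1)] by simp
  qed
qed

end

section \<open>The matrices of \<open>As\<close> and \<open>A\<close> in the basis
  \<open>Es i u\<close>\<close>

theorem proposition6p12:
  fixes scale :: "'a::field \<Rightarrow> 'b::ab_group_add \<Rightarrow> 'b"
    and d :: nat
    and A As :: "'b \<Rightarrow> 'b"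
    and E Es :: "nat \<Rightarrow> 'b \<Rightarrow> 'b"
    and \<theta> \<theta>s \<phi> :: "nat \<Rightarrow> 'a"
    and u :: 'b
  assumes "vector_space scale"
    and "d \<ge> 3"
    and "vector_space.dim scale (UNIV :: 'b set) = d + 1"
    and "vector_space.CH_system scale d A E As Es"
    and "vector_space.eigenvalue_sequence scale d A E \<theta>"
    and "vector_space.eigenvalue_sequence scale d As Es \<theta>s"
    and "vector_space.split_sequence scale d A As \<theta> \<theta>s \<phi>"
    and "u \<in> range (E 0)"
    and "u \<noteq> 0"
  shows "vector_space.indexed_basis scale d (\<lambda>i. Es i u) \<and>
    vector_space.represents scale d (\<lambda>i j. if i = j then \<theta>s i else 0) As (\<lambda>i. Es i u) \<and>
    (\<exists>M a b c \<xi>.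
       vector_space.represents scale d M A (\<lambda>i. Es i u) \<and>
       circular_Hessenberg d M \<and>
       (\<forall>i\<in>{0..d}. M i i = a i) \<and>
       (\<forall>i\<in>{0..d-1}. M i (i + 1) = b i) \<and>
       (\<forall>i\<in>{1..d}. M i (i - 1) = c i) \<and>
       M 0 d = \<xi> \<and>
       (\<forall>i\<in>{0..d}. \<forall>j\<in>{0..d}.
          i \<noteq> j \<and> j \<noteq> i + 1 \<and> i \<noteq> j + 1 \<and> (i, j) \<noteq> (0, d) \<longrightarrow> M i j = 0) \<and>
       \<xi> = \<theta> 0 - a 0 - b 0 \<and>
       (\<forall>i\<in>{1..d}.
          c i = (\<Prod>h=i+1..d. \<theta>s i - \<theta>s h) / (\<Prod>h=i..d. \<theta>s (i - 1) - \<theta>s h) * \<phi> i) \<and>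
       a 0 = \<theta> d + \<phi> 1 / (\<theta>s 0 - \<theta>s 1) \<and>
       (\<forall>i\<in>{1..d-1}.
          a i = \<theta> (d - i) + \<phi> (i + 1) / (\<theta>s i - \<theta>s (i + 1))
                + \<phi> i / (\<theta>s i - \<theta>s (i - 1))) \<and>
       a d = \<theta> 0 + \<phi> d / (\<theta>s d - \<theta>s (d - 1)) \<and>
       b 0 = (\<Prod>h=2..d. \<theta>s 0 - \<theta>s h) / (\<Prod>h=2..d. \<theta>s 1 - \<theta>s h)
             * (\<theta> (d - 1) - \<theta> d + \<phi> 2 / (\<theta>s 0 - \<theta>s 2) + \<phi> 1 / (\<theta>s 1 - \<theta>s 0)) \<and>
       (\<forall>i\<in>{1..d-2}.
          b i = (\<Prod>h=i+2..d. \<theta>s i - \<theta>s h) / (\<Prod>h=i+2..d. \<theta>s (i + 1) - \<theta>s h)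
                * (\<theta> (d - i - 1) - \<theta> (d - i) + \<phi> (i + 2) / (\<theta>s i - \<theta>s (i + 2))
                   + \<phi> (i + 1) / (\<theta>s (i + 1) - \<theta>s i)
                   + \<phi> i / (\<theta>s (i - 1) - \<theta>s (i + 1)))) \<and>
       b (d - 1) = \<theta> 0 - \<theta> 1 + \<phi> d / (\<theta>s d - \<theta>s (d - 1))
                   + \<phi> (d - 1) / (\<theta>s (d - 2) - \<theta>s d))"
proof -
  interpret vector_space scale by fact
  note d = assms(2)
  have CH: "multiplicity_free A" "multiplicity_free As"
    "ordering_of_primitive_idempotents d As Es" "CH_relations d Es A"
    using assms(4) by (auto simp: CH_system_def)
  have A: "Vector_Spaces.linear scale scale A"
    using CH(1) by (simp add: multiplicity_free_def)
  note B = CH(2,3) assms(6)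
  obtain w where \<phi>: "\<forall>i\<in>{1..d}. \<phi> i \<noteq> 0" and w: "indexed_basis d w"
    and repA: "represents d
      (\<lambda>i j. if i = j then \<theta> (d - i) else if i = j + 1 then 1 else 0) A w"
    and repB: "represents d
      (\<lambda>i j. if i = j then \<theta>s i else if j = i + 1 then \<phi> j else 0) As w"
    using assms(7) unfolding split_sequence_def by blast
  have "primitive_idempotent A (\<theta> 0) (E 0)"
    using assms(5) by (simp add: eigenvalue_sequence_def)
  from split_basis_last[where \<theta> = \<theta>, OF CH(1) this w repA assms(8)]
  obtain \<alpha> where u: "u = scale \<alpha> (w d)" .
  have e: "indexed_basis d (\<lambda>i. Es i u)"
  proof (rule indexed_basis_spanning[OF w])
    fix j assume j: "j \<le> d"
    let ?c = "\<alpha> * (\<Prod>h=Suc j..d. \<phi> h)"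
    \<comment> \<open>\<open>\<alpha>\<close> is nonzero because \<open>u\<close> is, so each
      \<open>w j\<close> can be recovered from its rescaled version, a combination of the
      \<open>Es i u\<close>.\<close>
    have "?c \<noteq> 0" using u assms(9) \<phi> by auto
    then have "w j = scale (1 / ?c) (scale ?c (w j))" by simp
    also have "\<dots> \<in> span ((\<lambda>i. Es i u) ` {..d})"
      unfolding rescaled_split_basis_expansion[OF B w repB u j]
      by (intro span_scale span_sum span_base) auto
    finally show "w j \<in> span ((\<lambda>i. Es i u) ` {..d})" .
  qed
  have repAs: "represents d (\<lambda>i j. if i = j then \<theta>s i else 0) As (\<lambda>i. Es i u)"
    unfolding represents_def
  proof (intro allI impI)
    fix j assume j: "j \<le> d"
    have "As (Es j u) = scale (\<theta>s j) (Es j u)"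
      using primitive_idempotent_range[OF CH(2), of "\<theta>s j" "Es j" u] assms(6) j
      by (simp add: eigenspace_def eigenvalue_sequence_def)
    also have "\<dots> = (\<Sum>i\<le>d. if i = j then scale (\<theta>s j) (Es j u) else 0)"
      using j by simp
    also have "\<dots> = (\<Sum>i\<le>d. scale (if i = j then \<theta>s i else 0) (Es i u))"
      by (rule sum.cong) auto
    finally show "As (Es j u) = \<dots>" .
  qed
  obtain M where M: "represents d M A (\<lambda>i. Es i u)"
    using indexed_basis_represents[OF e] .
  note entry = represents_idempotent_entry_eq_0_iff[OF A B e M]
  have zero: "M i j = 0" if "i \<le> d" "j \<le> d" "j + 1 < i \<or> i + 1 < j \<and> j < i + d" for i j
    using that CH(4) entry[of i j] unfolding CH_relations_def by blast
  \<comment> \<open>With both indices at most \<open>d\<close>, \<open>j = i + d\<close> describes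
    the corner \<open>(0, d)\<close> alone.\<close>
  have nonzero: "M i j \<noteq> 0" if "i \<le> d" "j \<le> d" "i = j + 1 \<or> j = i + d" for i j
    using that CH(4) entry[of i j] unfolding CH_relations_def by blast
  interpret bidiagonal_rows d \<theta> \<theta>s \<phi> M
    by (rule split_basis_bidiagonal_rows[OF A B w repA repB u e M]) (auto intro: zero)
  have hess: "circular_Hessenberg d M"
    unfolding circular_Hessenberg_def using nonzero[of 0 d] by (auto intro: zero simp: nonzero)
  have corner: "M 0 d = \<theta> 0 - M 0 0 - M 0 (0 + 1)"
    using corner_entry zero[of 0] d by simp
  have sub: "\<forall>i\<in>{1..d}. M i (i - 1) =
      (\<Prod>h=i+1..d. \<theta>s i - \<theta>s h) / (\<Prod>h=i..d. \<theta>s (i - 1) - \<theta>s h) * \<phi> i"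
  proof
    fix i assume "i \<in> {1..d}"
    then show "M i (i - 1) =
        (\<Prod>h=i+1..d. \<theta>s i - \<theta>s h) / (\<Prod>h=i..d. \<theta>s (i - 1) - \<theta>s h) * \<phi> i"
      using subdiagonal_entry[of "i - 1"] by (cases i) (simp_all add: tau_def)
  qed
  have super: "M i (i + 1) =
      (\<Prod>h=i+2..d. \<theta>s i - \<theta>s h) / (\<Prod>h=i+2..d. \<theta>s (i + 1) - \<theta>s h) *
      (\<theta> (d - i - 1) - \<theta> (d - i)
        + (if i + 1 < d then \<phi> (i + 2) / (\<theta>s i - \<theta>s (i + 2)) else 0)
        + \<phi> (i + 1) / (\<theta>s (i + 1) - \<theta>s i)
        + (if 0 < i then \<phi> i / (\<theta>s (i - 1) - \<theta>s (i + 1)) else 0))" if "i < d" for i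
    using superdiagonal_entry[OF that] by (simp add: tau_def)
  show ?thesis
  \<comment> \<open>\<open>a\<close>, \<open>b\<close>, \<open>c\<close> and \<open>\<xi>\<close>
    are read off from \<open>M\<close>, so what remains is the shape of \<open>M\<close> and the
    closed formulas.\<close>
  proof (rule conjI[OF e conjI[OF repAs]], rule exI[of _ M], rule exI[of _ "\<lambda>i. M i i"],
      rule exI[of _ "\<lambda>i. M i (i + 1)"], rule exI[of _ "\<lambda>i. M i (i - 1)"],
      rule exI[of _ "M 0 d"], intro conjI)
    show "\<forall>i\<in>{0..d}. \<forall>j\<in>{0..d}.
        i \<noteq> j \<and> j \<noteq> i + 1 \<and> i \<noteq> j + 1 \<and> (i, j) \<noteq> (0, d) \<longrightarrow> M i j = 0"
      by (auto intro!: zero)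
    show "M 0 0 = \<theta> d + \<phi> 1 / (\<theta>s 0 - \<theta>s 1)"
      using diagonal_entry[of 0] d by simp
    show "\<forall>i\<in>{1..d-1}. M i i = \<theta> (d - i) + \<phi> (i + 1) / (\<theta>s i - \<theta>s (i + 1))
        + \<phi> i / (\<theta>s i - \<theta>s (i - 1))"
    proof
      fix i assume "i \<in> {1..d-1}"
      then have "0 < i" "i < d" using d by auto
      then show "M i i = \<theta> (d - i) + \<phi> (i + 1) / (\<theta>s i - \<theta>s (i + 1))
          + \<phi> i / (\<theta>s i - \<theta>s (i - 1))"
        using diagonal_entry[of i] by simp
    qed
    show "M d d = \<theta> 0 + \<phi> d / (\<theta>s d - \<theta>s (d - 1))"
      using diagonal_entry[of d] d by simp
    show "M 0 (0 + 1) = (\<Prod>h=2..d. \<theta>s 0 - \<theta>s h) / (\<Prod>h=2..d. \<theta>s 1 - \<theta>s h)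
        * (\<theta> (d - 1) - \<theta> d + \<phi> 2 / (\<theta>s 0 - \<theta>s 2) + \<phi> 1 / (\<theta>s 1 - \<theta>s 0))"
      using super[of 0] d by (simp add: numeral_2_eq_2)
    show "\<forall>i\<in>{1..d-2}. M i (i + 1) =
        (\<Prod>h=i+2..d. \<theta>s i - \<theta>s h) / (\<Prod>h=i+2..d. \<theta>s (i + 1) - \<theta>s h)
        * (\<theta> (d - i - 1) - \<theta> (d - i) + \<phi> (i + 2) / (\<theta>s i - \<theta>s (i + 2))
          + \<phi> (i + 1) / (\<theta>s (i + 1) - \<theta>s i)
          + \<phi> i / (\<theta>s (i - 1) - \<theta>s (i + 1)))"
    proof
      fix i assume "i \<in> {1..d-2}"
      then have "0 < i" "i < d" "i + 1 < d" using d by auto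
      then show "M i (i + 1) =
        (\<Prod>h=i+2..d. \<theta>s i - \<theta>s h) / (\<Prod>h=i+2..d. \<theta>s (i + 1) - \<theta>s h)
        * (\<theta> (d - i - 1) - \<theta> (d - i) + \<phi> (i + 2) / (\<theta>s i - \<theta>s (i + 2))
          + \<phi> (i + 1) / (\<theta>s (i + 1) - \<theta>s i)
          + \<phi> i / (\<theta>s (i - 1) - \<theta>s (i + 1)))"
        using super[of i] by (simp only: if_True)
    qed
    \<comment> \<open>At \<open>i = d - 1\<close> both products in \<open>super\<close> are empty
      and the term with \<open>\<phi> (i + 2)\<close> drops out.\<close>
    have "d - 1 < d" "d - 1 + 1 = d" "0 < d - 1" "d - 1 - 1 = d - 2" "d - (d - 1) = 1"
      using d by auto
    then show "M (d - 1) (d - 1 + 1) = \<theta> 0 - \<theta> 1 + \<phi> d / (\<theta>s d - \<theta>s (d - 1))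
        + \<phi> (d - 1) / (\<theta>s (d - 2) - \<theta>s d)"
      using super[of "d - 1"] by simp
  qed (use M hess corner sub in simp_all)
qed

end
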